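(* Let $G$ be a connected bridgeless cubic $(n,m)$-graph (multiple edges allowed) all of whose flow roots are real, and write $F(G,t)=\sum_{i=0}^{m-n+1}c_i t^i$. Then for all $0\leqslant i\leqslant m-n+1$ one has $b_i\leqslant |c_i|$, where the numbers $b_i$ are defined by $$\sum_{i=0}^{m-n+1}b_i t^i=(t+1)(t+2)^{n/2}.$$
   Context: All graphs are finite and may have loops and multiple edges (a loop contributes 2 to the degree of its vertex). An $(n,m)$-graph is a graph with $n$ vertices and $m$ edges; a cubic graph is one in which every vertex has degree 3. The flow polynomial of an $(n,m)$-graph $G$ is $$F(G,t)=\sum_{Z\subseteq E(G)}(-1)^{m-|Z|}\,t^{|Z|+c(Z)-n},$$ where $c(Z)$ is the number of connected components of the spanning subgraph of $G$ with vertex set $V(G)$ and edge set $Z$. A flow root of $G$ is a (complex) zero of $F(G,t)$. *)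

theory Defs
  imports Complex_Main "HOL-Library.Multiset" "HOL-Computational_Algebra.Polynomial"
begin

(* The ends of an edge form a two-element multiset: {#u, v#} for an edge joining
   u and v, and {#v, v#} for a loop at v. Distinct edges may share their ends. *)
record ('v, 'e) multigraph =
  verts :: "'v set"
  edges :: "'e set"
  ends :: "'e \<Rightarrow> 'v multiset"

definition finite_multigraph :: "('v, 'e) multigraph \<Rightarrow> bool" where
  "finite_multigraph G \<longleftrightarrow>
     finite (verts G) \<and> finite (edges G) \<and>
     (\<forall>e\<in>edges G. size (ends G e) = 2 \<and> set_mset (ends G e) \<subseteq> verts G)"

(* A loop at v has multiplicity 2 at v, so it contributes 2. *)
definition degree_at :: "('v, 'e) multigraph \<Rightarrow> 'v \<Rightarrow> nat" where
  "degree_at G v = (\<Sum>e\<in>edges G. count (ends G e) v)"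

definition cubic :: "('v, 'e) multigraph \<Rightarrow> bool" where
  "cubic G \<longleftrightarrow> (\<forall>v\<in>verts G. degree_at G v = 3)"

definition adjacent_via :: "('v, 'e) multigraph \<Rightarrow> 'e set \<Rightarrow> ('v \<times> 'v) set" where
  "adjacent_via G Z = {(u, v). \<exists>e\<in>Z. ends G e = {#u, v#}}"

definition joined_via :: "('v, 'e) multigraph \<Rightarrow> 'e set \<Rightarrow> ('v \<times> 'v) set" where
  "joined_via G Z = {(u, v) \<in> verts G \<times> verts G. (u, v) \<in> (adjacent_via G Z)\<^sup>*}"

definition num_components :: "('v, 'e) multigraph \<Rightarrow> 'e set \<Rightarrow> nat" where
  "num_components G Z = card (verts G // joined_via G Z)"

(* In particular the graph without vertices is not connected. *)
definition connected_graph :: "('v, 'e) multigraph \<Rightarrow> bool" where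
  "connected_graph G \<longleftrightarrow> num_components G (edges G) = 1"

definition bridge :: "('v, 'e) multigraph \<Rightarrow> 'e \<Rightarrow> bool" where
  "bridge G e \<longleftrightarrow>
     e \<in> edges G \<and> num_components G (edges G - {e}) > num_components G (edges G)"

definition bridgeless :: "('v, 'e) multigraph \<Rightarrow> bool" where
  "bridgeless G \<longleftrightarrow> (\<forall>e\<in>edges G. \<not> bridge G e)"

(* Neither subtraction on nat truncates for a finite multigraph: card Z is at most
   the number of edges, and a spanning subgraph with edge set Z has at least
   card (verts G) - card Z components. *)
definition flow_poly :: "('v, 'e) multigraph \<Rightarrow> int poly" where
  "flow_poly G =
     (\<Sum>Z\<in>Pow (edges G).
        monom ((-1) ^ (card (edges G) - card Z))
              (card Z + num_components G Z - card (verts G)))"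

definition flow_root :: "('v, 'e) multigraph \<Rightarrow> complex \<Rightarrow> bool" where
  "flow_root G z \<longleftrightarrow> poly (map_poly of_int (flow_poly G)) z = 0"

end

theory Submission
  imports Defs "HOL-Computational_Algebra.Fundamental_Theorem_Algebra"
begin

text \<open>Among monic polynomials of degree \<open>d\<close> with positive roots, the product of whose roots is at least
\<open>2 ^ d\<close>, the polynomial \<open>(t - 2) ^ d\<close> has the smallest coefficients in absolute value: the
coefficients are elementary symmetric functions of the roots, and the inequality between arithmetic
and geometric means, in the form \<open>1 + x \<le> exp x\<close>, applies to each of them
(\<open>coeff_prod_linear_ge\<close>). The flow polynomial \<open>F\<close> of a connected bridgeless cubic graph on
\<open>n = 2 * d\<close> vertices is monic of degree \<open>d + 1\<close> and has the root \<open>1\<close>. So it suffices to see that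
all its roots are positive and that their product \<open>\<bar>F(0)\<bar>\<close> is at least \<open>2 ^ d\<close>; multiplication by
\<open>t + 1\<close> preserves coefficientwise inequalities.

Both follow from one bound: for \<open>t \<le> 0\<close>, a 2-edge-connected graph with \<open>k\<close> vertices of degree three
satisfies \<open>\<bar>F(t)\<bar> \<ge> sqrt 2 ^ k\<close> (\<open>signed_flow_ge\<close>). It is proved by deletion and contraction, where
with the right sign both terms are nonnegative. A loop only contributes a factor of absolute value at
least one. In a graph without loops but with edges, if the graph remains 2-edge-connected after the
deletion of some edge, then both terms satisfy the bound with \<open>k - 2\<close> in place of \<open>k\<close>, and
\<open>2 * sqrt 2 ^ (k - 2) = sqrt 2 ^ k\<close>. If no such edge exists, then uncrossing two-edge
cuts produces a vertex of degree two (\<open>removable_edge_or_degree_two\<close>), and contracting an edge at that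
vertex keeps \<open>k\<close>.

The numbers of components are handled through the identity that \<open>2 ^ c(Z)\<close> is the number of vertex
sets that no edge of \<open>Z\<close> leaves (\<open>two_power_num_components\<close>).\<close>

section \<open>Counting components by unsplit vertex sets\<close>

definition splits :: "'v set \<Rightarrow> 'v set \<Rightarrow> bool" where
  "splits S X \<longleftrightarrow> S \<inter> X \<noteq> {} \<and> \<not> S \<subseteq> X"

definition cut_edges :: "('v, 'e) multigraph \<Rightarrow> 'v set \<Rightarrow> 'e set" where
  "cut_edges G X = {e \<in> edges G. splits (set_mset (ends G e)) X}"

text \<open>Unions of components of the spanning subgraph with edge set \<open>Z\<close>.\<close>

definition unsplit_sets :: "('v, 'e) multigraph \<Rightarrow> 'e set \<Rightarrow> 'v set set" where
  "unsplit_sets G Z = {X. X \<subseteq> verts G \<and> (\<forall>e\<in>Z. \<not> splits (set_mset (ends G e)) X)}"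

lemma ends_cases:
  assumes "finite_multigraph G" "e \<in> edges G"
  obtains u v where "ends G e = {#u, v#}" "u \<in> verts G" "v \<in> verts G"
proof -
  have "size (ends G e) = 2" and sub: "set_mset (ends G e) \<subseteq> verts G"
    using assms by (auto simp: finite_multigraph_def)
  then obtain u N where "ends G e = add_mset u N" "size N = 1"
    by (metis One_nat_def Suc_inject numeral_2_eq_2 size_add_mset size_eq_Suc_imp_eq_union)
  then obtain v where "ends G e = {#u, v#}" using size_1_singleton_mset by blast
  with sub show ?thesis by (intro that[of u v]) auto
qed

lemma finite_unsplit_sets: "finite_multigraph G \<Longrightarrow> finite (unsplit_sets G Z)"
  by (rule finite_subset[of _ "Pow (verts G)"]) (auto simp: unsplit_sets_def finite_multigraph_def)

lemma equiv_joined_via: "equiv (verts G) (joined_via G Z)"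
proof -
  have "sym (adjacent_via G Z)"
    by (auto simp: sym_def adjacent_via_def add_mset_commute)
  then have "sym ((adjacent_via G Z)\<^sup>*)" by (rule sym_rtrancl)
  then show ?thesis
    by (intro equivI) (auto simp: refl_on_def sym_def trans_def joined_via_def)
qed

lemma unsplit_sets_joined:
  assumes "X \<in> unsplit_sets G Z" "(u, v) \<in> joined_via G Z" "u \<in> X"
  shows "v \<in> X"
proof -
  have "(u, v) \<in> (adjacent_via G Z)\<^sup>*" using assms(2) by (simp add: joined_via_def)
  then show ?thesis
  proof (induction rule: rtrancl_induct)
    case base
    then show ?case by (rule assms(3))
  next
    case (step y z)
    then obtain e where "e \<in> Z" "ends G e = {#y, z#}" by (auto simp: adjacent_via_def)
    with assms(1) step.IH show ?case by (auto simp: unsplit_sets_def splits_def)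
  qed
qed

text \<open>A vertex set that no edge of \<open>Z\<close> splits is the same thing as a set of components, so these sets
are counted by a power of two. They behave better than the components themselves: how their number
changes when an edge is added or contracted can be read off from explicit bijections.\<close>

lemma two_power_num_components:
  assumes fin: "finite_multigraph G" and Z: "Z \<subseteq> edges G"
  shows "2 ^ num_components G Z = card (unsplit_sets G Z)"
proof -
  let ?R = "joined_via G Z" and ?V = "verts G"
  have eq: "equiv ?V ?R" by (rule equiv_joined_via)
  have finV: "finite ?V" using fin by (simp add: finite_multigraph_def)
  have finQ: "finite (?V // ?R)"
    using finV by (intro finite_quotient) (auto simp: joined_via_def)
  have "bij_betw Union (Pow (?V // ?R)) (unsplit_sets G Z)"
  proof (rule bij_betw_byWitness[where f' = "\<lambda>X. {C \<in> ?V // ?R. C \<subseteq> X}"])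
    show "\<forall>\<C>\<in>Pow (?V // ?R). {C \<in> ?V // ?R. C \<subseteq> \<Union>\<C>} = \<C>"
    proof (intro ballI equalityI subsetI)
      fix \<C> C assume \<C>: "\<C> \<in> Pow (?V // ?R)" and C: "C \<in> {C \<in> ?V // ?R. C \<subseteq> \<Union>\<C>}"
      then obtain x where "x \<in> C" using in_quotient_imp_non_empty[OF eq] by blast
      then obtain D where "D \<in> \<C>" "x \<in> D" using C by blast
      then have "C = D"
        using quotient_disj[OF eq, of C D] C \<C> \<open>x \<in> C\<close> by blast
      then show "C \<in> \<C>" using \<open>D \<in> \<C>\<close> by simp
    qed auto
    show "\<forall>X\<in>unsplit_sets G Z. \<Union>{C \<in> ?V // ?R. C \<subseteq> X} = X"
    proof (intro ballI equalityI subsetI)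
      fix X x assume X: "X \<in> unsplit_sets G Z" and x: "x \<in> X"
      then have "x \<in> ?V" by (auto simp: unsplit_sets_def)
      then have "x \<in> ?R `` {x}" "?R `` {x} \<in> ?V // ?R"
        using equiv_class_self[OF eq] by (auto intro: quotientI)
      moreover have "?R `` {x} \<subseteq> X" using unsplit_sets_joined[OF X _ x] by blast
      ultimately show "x \<in> \<Union>{C \<in> ?V // ?R. C \<subseteq> X}" by blast
    qed auto
    show "\<Union> ` Pow (?V // ?R) \<subseteq> unsplit_sets G Z"
    proof (rule image_subsetI)
      fix \<C> assume \<C>: "\<C> \<in> Pow (?V // ?R)"
      have "\<not> splits (set_mset (ends G e)) (\<Union>\<C>)" if "e \<in> Z" for e
      proof -
        obtain u v where e: "ends G e = {#u, v#}" "u \<in> ?V" "v \<in> ?V"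
          using ends_cases[OF fin, of e] \<open>e \<in> Z\<close> Z by blast
        then have "(u, v) \<in> ?R" "(v, u) \<in> ?R"
          using \<open>e \<in> Z\<close>
          by (auto simp: joined_via_def adjacent_via_def add_mset_commute intro!: r_into_rtrancl)
        then have "u \<in> C \<longleftrightarrow> v \<in> C" if "C \<in> \<C>" for C
          using in_quotient_imp_closed[OF eq, of C] that \<C> by blast
        then show ?thesis by (auto simp: splits_def e(1))
      qed
      then show "\<Union>\<C> \<in> unsplit_sets G Z"
        using \<C> Union_quotient[OF eq] by (auto simp: unsplit_sets_def)
    qed
    show "(\<lambda>X. {C \<in> ?V // ?R. C \<subseteq> X}) ` unsplit_sets G Z \<subseteq> Pow (?V // ?R)" by auto
  qed
  then have "card (Pow (?V // ?R)) = card (unsplit_sets G Z)" by (rule bij_betw_same_card)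
  then show ?thesis by (simp add: card_Pow finQ num_components_def)
qed

lemma num_components_insert_same:
  assumes fin: "finite_multigraph G" and Z: "insert e Z \<subseteq> edges G"
    and "\<And>X. X \<in> unsplit_sets G Z \<Longrightarrow> \<not> splits (set_mset (ends G e)) X"
  shows "num_components G (insert e Z) = num_components G Z"
proof -
  have "unsplit_sets G (insert e Z) = unsplit_sets G Z"
    using assms(3) by (auto simp: unsplit_sets_def)
  then have "(2::nat) ^ num_components G (insert e Z) = 2 ^ num_components G Z"
    using two_power_num_components[OF fin, of "insert e Z"] two_power_num_components[OF fin, of Z] Z
    by simp
  then show ?thesis by simp
qed

text \<open>An edge has two ends, so it splits a symmetric difference of two sets if and only if it splits
exactly one of them. If \<open>e\<close> splits \<open>X\<close>, then symmetric difference with \<open>X\<close> exchanges the unsplit sets that \<open>e\<close> splits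
with those that it does not split. Hence exactly half of them survive the addition of \<open>e\<close>.\<close>

lemma num_components_insert_less:
  assumes fin: "finite_multigraph G" and Z: "insert e Z \<subseteq> edges G"
    and X: "X \<in> unsplit_sets G Z" "splits (set_mset (ends G e)) X"
  shows "num_components G Z = Suc (num_components G (insert e Z))"
proof -
  let ?U = "unsplit_sets G Z" and ?W = "unsplit_sets G (insert e Z)"
  let ?f = "\<lambda>Y. (Y - X) \<union> (X - Y)"
  have two: "\<exists>u v. set_mset (ends G e) = {u, v}" if "e \<in> edges G" for e
    using ends_cases[OF fin that] by (metis set_mset_add_mset_insert set_mset_empty)
  have f_U: "?f Y \<in> ?U" if "Y \<in> ?U" for Y
  proof -
    have "\<not> splits (set_mset (ends G g)) (?f Y)" if "g \<in> Z" for g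
    proof -
      obtain u v where uv: "set_mset (ends G g) = {u, v}" using two[of g] Z \<open>g \<in> Z\<close> by blast
      have "\<not> splits {u, v} X" "\<not> splits {u, v} Y"
        using that X(1) \<open>Y \<in> ?U\<close> uv by (auto simp: unsplit_sets_def)
      then show ?thesis unfolding uv by (auto simp: splits_def)
    qed
    with that X(1) show ?thesis by (auto simp: unsplit_sets_def)
  qed
  obtain u v where uv: "set_mset (ends G e) = {u, v}" using two[of e] Z by blast
  have flip: "splits {u, v} (?f Y) \<longleftrightarrow> \<not> splits {u, v} Y" for Y
    using X(2) by (auto simp: splits_def uv)
  have W: "?W = {Y \<in> ?U. \<not> splits {u, v} Y}" by (auto simp: unsplit_sets_def uv)
  have "bij_betw ?f ?W (?U - ?W)"
  proof (rule bij_betw_byWitness[where f' = ?f])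
    show "?f ` ?W \<subseteq> ?U - ?W"
    proof (rule image_subsetI)
      fix Y assume "Y \<in> ?W"
      then show "?f Y \<in> ?U - ?W" using f_U[of Y] flip[of Y] unfolding W by blast
    qed
    show "?f ` (?U - ?W) \<subseteq> ?W"
    proof (rule image_subsetI)
      fix Y assume "Y \<in> ?U - ?W"
      then show "?f Y \<in> ?W" using f_U[of Y] flip[of Y] unfolding W by blast
    qed
  qed auto
  then have "card ?W = card (?U - ?W)" by (rule bij_betw_same_card)
  moreover have "card ?U = card ?W + card (?U - ?W)"
    using card_Int_Diff[OF finite_unsplit_sets[OF fin, of Z], of ?W] W
    by (simp add: Int_absorb1)
  ultimately have "2 ^ num_components G Z = (2::nat) * 2 ^ num_components G (insert e Z)"
    using two_power_num_components[OF fin, of "insert e Z"] two_power_num_components[OF fin, of Z] Z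
    by simp
  then have "(2::nat) ^ num_components G Z = 2 ^ Suc (num_components G (insert e Z))" by simp
  then show ?thesis by (simp only: power_inject_exp)
qed

lemma num_components_le_Suc_insert:
  assumes "finite_multigraph G" "insert e Z \<subseteq> edges G"
  shows "num_components G Z \<le> Suc (num_components G (insert e Z))"
  using num_components_insert_same[OF assms] num_components_insert_less[OF assms]
  by (cases "\<exists>X \<in> unsplit_sets G Z. splits (set_mset (ends G e)) X") auto

section \<open>Deletion and contraction for the flow polynomial\<close>

definition delete_edge :: "('v, 'e) multigraph \<Rightarrow> 'e \<Rightarrow> ('v, 'e) multigraph" where
  "delete_edge G e = G\<lparr>edges := edges G - {e}\<rparr>"

text \<open>Meant for an edge \<open>e\<close> that joins distinct vertices \<open>u\<close> and \<open>v\<close>: the vertex \<open>v\<close> is merged into \<open>u\<close>.\<close>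

definition contract_edge :: "('v, 'e) multigraph \<Rightarrow> 'e \<Rightarrow> 'v \<Rightarrow> 'v \<Rightarrow> ('v, 'e) multigraph" where
  "contract_edge G e u v =
     G\<lparr>verts := verts G - {v}, edges := edges G - {e},
       ends := \<lambda>g. image_mset (id(v := u)) (ends G g)\<rparr>"

lemma delete_edge_simps [simp]:
  "verts (delete_edge G e) = verts G"
  "edges (delete_edge G e) = edges G - {e}"
  "ends (delete_edge G e) = ends G"
  by (simp_all add: delete_edge_def)

lemma contract_edge_simps [simp]:
  "verts (contract_edge G e u v) = verts G - {v}"
  "edges (contract_edge G e u v) = edges G - {e}"
  "ends (contract_edge G e u v) g = image_mset (id(v := u)) (ends G g)"
  by (simp_all add: contract_edge_def)

lemma finite_multigraph_delete: "finite_multigraph G \<Longrightarrow> finite_multigraph (delete_edge G e)"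
  by (auto simp: finite_multigraph_def)

lemma finite_multigraph_contract:
  assumes "finite_multigraph G" "u \<in> verts G" "u \<noteq> v"
  shows "finite_multigraph (contract_edge G e u v)"
  using assms by (auto simp: finite_multigraph_def)

lemma num_components_delete [simp]: "num_components (delete_edge G e) Z = num_components G Z"
  by (simp add: num_components_def joined_via_def adjacent_via_def)

lemma splits_image: "splits (f ` S) X \<longleftrightarrow> splits S (f -` X)"
  by (auto simp: splits_def)

text \<open>A vertex set that contains both or none of \<open>u\<close> and \<open>v\<close> is determined by what remains of it after
\<open>v\<close> is removed. Hence contracting an edge and adding it have the same effect on unsplit sets, and so
on the number of components.\<close>

lemma contraction_preimage:
  assumes "u \<noteq> v" "v \<in> verts G" "u \<in> verts G"
  shows "bij_betw (\<lambda>X. (id(v := u)) -` X) (Pow (verts G - {v}))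
           {X. X \<subseteq> verts G \<and> \<not> splits {u, v} X}"
proof (rule bij_betw_byWitness[where f' = "\<lambda>X. X - {v}"])
  show "\<forall>a\<in>Pow (verts G - {v}). (id(v := u)) -` a - {v} = a"
    by auto
  show "\<forall>a'\<in>{X. X \<subseteq> verts G \<and> \<not> splits {u, v} X}. (id(v := u)) -` (a' - {v}) = a'"
    using assms by (auto simp: splits_def split: if_splits)
  show "(\<lambda>X. (id(v := u)) -` X) ` Pow (verts G - {v}) \<subseteq> {X. X \<subseteq> verts G \<and> \<not> splits {u, v} X}"
    using assms by (auto simp: splits_def split: if_splits)
  show "(\<lambda>X. X - {v}) ` {X. X \<subseteq> verts G \<and> \<not> splits {u, v} X} \<subseteq> Pow (verts G - {v})"
    by auto
qed

lemma num_components_contract: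
  assumes fin: "finite_multigraph G" and e: "e \<in> edges G" "ends G e = {#u, v#}" "u \<noteq> v"
    and Z: "Z \<subseteq> edges G - {e}"
  shows "num_components (contract_edge G e u v) Z = num_components G (insert e Z)"
proof -
  let ?H = "contract_edge G e u v" and ?f = "\<lambda>X. (id(v := u)) -` X"
  have uv: "u \<in> verts G" "v \<in> verts G" using fin e by (auto simp: finite_multigraph_def)
  have "bij_betw ?f (unsplit_sets ?H Z) (unsplit_sets G (insert e Z))"
  proof (rule bij_betw_subset[OF contraction_preimage[OF \<open>u \<noteq> v\<close> uv(2,1)]])
    show sub: "unsplit_sets ?H Z \<subseteq> Pow (verts G - {v})" by (auto simp: unsplit_sets_def)
    have pre: "X \<in> unsplit_sets ?H Z \<longleftrightarrow> ?f X \<in> unsplit_sets G (insert e Z)" if "X \<subseteq> verts G - {v}" for X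
    proof -
      have "?f X \<in> {X. X \<subseteq> verts G \<and> \<not> splits {u, v} X}"
        using bij_betwE[OF contraction_preimage[OF \<open>u \<noteq> v\<close> uv(2,1)]] that by blast
      moreover have "splits (set_mset (ends ?H g)) X \<longleftrightarrow> splits (set_mset (ends G g)) (?f X)" for g
        by (simp only: contract_edge_simps set_image_mset splits_image)
      moreover have "set_mset (ends G e) = {u, v}" by (simp add: e(2))
      ultimately show ?thesis
        using that unfolding unsplit_sets_def by (simp del: contract_edge_simps(3) fun_upd_apply)
    qed
    have "{X. X \<subseteq> verts G \<and> \<not> splits {u, v} X} = ?f ` Pow (verts G - {v})"
      using contraction_preimage[OF \<open>u \<noteq> v\<close> uv(2,1)] by (simp add: bij_betw_def)
    moreover have "unsplit_sets G (insert e Z) \<subseteq> {X. X \<subseteq> verts G \<and> \<not> splits {u, v} X}"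
      by (auto simp: unsplit_sets_def e(2))
    ultimately have onto: "unsplit_sets G (insert e Z) \<subseteq> ?f ` Pow (verts G - {v})" by simp
    show "?f ` unsplit_sets ?H Z = unsplit_sets G (insert e Z)"
    proof (intro equalityI image_subsetI subsetI)
      fix X assume "X \<in> unsplit_sets ?H Z"
      then show "?f X \<in> unsplit_sets G (insert e Z)" using pre[of X] sub by blast
    next
      fix Y assume Y: "Y \<in> unsplit_sets G (insert e Z)"
      then obtain X where X: "X \<subseteq> verts G - {v}" "Y = ?f X" using onto by blast
      then have "X \<in> unsplit_sets ?H Z" using pre[of X] Y by simp
      then show "Y \<in> ?f ` unsplit_sets ?H Z" using X(2) by (rule rev_image_eqI)
    qed
  qed
  then have "card (unsplit_sets ?H Z) = card (unsplit_sets G (insert e Z))"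
    by (rule bij_betw_same_card)
  moreover have "2 ^ num_components ?H Z = card (unsplit_sets ?H Z)"
    using Z by (intro two_power_num_components finite_multigraph_contract fin uv \<open>u \<noteq> v\<close>) simp
  moreover have "2 ^ num_components G (insert e Z) = card (unsplit_sets G (insert e Z))"
    using Z e(1) by (intro two_power_num_components fin) blast
  ultimately have "(2::nat) ^ num_components ?H Z = 2 ^ num_components G (insert e Z)" by simp
  then show ?thesis by simp
qed

text \<open>This keeps the exponents in the flow polynomial free of truncated subtraction.\<close>

lemma card_verts_le:
  assumes fin: "finite_multigraph G" and "Z \<subseteq> edges G"
  shows "card (verts G) \<le> card Z + num_components G Z"
proof -
  have "finite Z" using assms finite_subset by (auto simp: finite_multigraph_def)
  then show ?thesis using assms(2)
  proof (induction Z rule: finite_induct)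
    case empty
    have "unsplit_sets G {} = Pow (verts G)" by (auto simp: unsplit_sets_def)
    then have "(2::nat) ^ num_components G {} = 2 ^ card (verts G)"
      using two_power_num_components[OF fin, of "{}"] fin
      by (simp add: card_Pow finite_multigraph_def)
    then show ?case by simp
  next
    case (insert e Z)
    then have "num_components G Z \<le> Suc (num_components G (insert e Z))"
      by (intro num_components_le_Suc_insert[OF fin insert.prems])
    with insert show ?case by simp
  qed
qed

definition flow_term :: "('v, 'e) multigraph \<Rightarrow> 'e set \<Rightarrow> int poly" where
  "flow_term G Z = monom ((-1) ^ (card (edges G) - card Z))
                     (card Z + num_components G Z - card (verts G))"

text \<open>The edge sets without \<open>e\<close> contribute the flow polynomial of the graph without \<open>e\<close>, with the
opposite sign because that graph has one edge less. The formulas for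
contraction, loops and bridges and the root \<open>1\<close> all come from evaluating the remaining sum.\<close>

lemma flow_poly_split_edge:
  assumes fin: "finite_multigraph G" and e: "e \<in> edges G"
  shows "flow_poly G = (\<Sum>Z\<in>Pow (edges G - {e}). flow_term G (insert e Z)) - flow_poly (delete_edge G e)"
proof -
  let ?E = "edges G - {e}"
  have finE: "finite (edges G)" using fin by (simp add: finite_multigraph_def)
  have "Pow (edges G) = Pow ?E \<union> insert e ` Pow ?E"
    using e Pow_insert[of e ?E] by (simp add: insert_absorb)
  moreover have "Pow ?E \<inter> insert e ` Pow ?E = {}" by auto
  moreover have "inj_on (insert e) (Pow ?E)" by (intro inj_onI) blast
  ultimately have "flow_poly G = (\<Sum>Z\<in>Pow ?E. flow_term G Z) + (\<Sum>Z\<in>Pow ?E. flow_term G (insert e Z))"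
    using finE by (simp add: flow_poly_def flow_term_def sum.union_disjoint sum.reindex)
  moreover have "flow_term G Z = - flow_term (delete_edge G e) Z" if "Z \<subseteq> ?E" for Z
  proof -
    have "card Z \<le> card ?E" using that finE by (intro card_mono) auto
    then have "card (edges G) - card Z = Suc (card ?E - card Z)"
      using card.remove[OF finE e] by simp
    then show ?thesis by (simp add: flow_term_def minus_monom)
  qed
  then have "(\<Sum>Z\<in>Pow ?E. flow_term G Z) = - flow_poly (delete_edge G e)"
    by (simp add: flow_poly_def flow_term_def[of "delete_edge G e"] sum_negf[symmetric])
  ultimately show ?thesis by simp
qed

context
  fixes G :: "('v, 'e) multigraph" and e :: 'e
  assumes fin: "finite_multigraph G" and e: "e \<in> edges G"
begin

lemma card_insert_edge:
  assumes "Z \<subseteq> edges G - {e}"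
  shows "card (insert e Z) = Suc (card Z)"
    and "card (edges G) - card (insert e Z) = card (edges G - {e}) - card Z"
proof -
  have finE: "finite (edges G)" using fin by (simp add: finite_multigraph_def)
  then have "finite Z" "e \<notin> Z" using assms finite_subset by auto
  then show "card (insert e Z) = Suc (card Z)" by simp
  then show "card (edges G) - card (insert e Z) = card (edges G - {e}) - card Z"
    using card.remove[OF finE e] by simp
qed

lemma flow_poly_deletion_contraction:
  assumes uv: "ends G e = {#u, v#}" "u \<noteq> v"
  shows "flow_poly G = flow_poly (contract_edge G e u v) - flow_poly (delete_edge G e)"
proof -
  have V: "finite (verts G)" "v \<in> verts G" using fin e uv by (auto simp: finite_multigraph_def)
  have "flow_term G (insert e Z) = flow_term (contract_edge G e u v) Z" if "Z \<subseteq> edges G - {e}" for Z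
    using card_insert_edge[OF that] num_components_contract[OF fin e uv that] card.remove[OF V]
    by (simp add: flow_term_def)
  then show ?thesis
    using flow_poly_split_edge[OF fin e] by (simp add: flow_poly_def flow_term_def)
qed

lemma flow_poly_loop:
  assumes v: "ends G e = {#v, v#}"
  shows "flow_poly G = [:-1, 1:] * flow_poly (delete_edge G e)"
proof -
  have "flow_term G (insert e Z) = [:0, 1:] * flow_term (delete_edge G e) Z"
    if Z: "Z \<subseteq> edges G - {e}" for Z
  proof -
    have "num_components G (insert e Z) = num_components G Z"
      using Z e by (intro num_components_insert_same[OF fin]) (auto simp: splits_def v)
    moreover have "card (verts G) \<le> card Z + num_components G Z"
      using Z by (intro card_verts_le[OF fin]) auto
    ultimately show ?thesis
      using card_insert_edge[OF Z] by (simp add: flow_term_def Suc_diff_le monom_Suc)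
  qed
  then have "(\<Sum>Z\<in>Pow (edges G - {e}). flow_term G (insert e Z)) = [:0, 1:] * flow_poly (delete_edge G e)"
    by (simp add: flow_poly_def flow_term_def[of "delete_edge G e"] sum_distrib_left)
  then show ?thesis
    using flow_poly_split_edge[OF fin e] by (simp add: algebra_simps)
qed

text \<open>Adding a bridge to an edge set \<open>Z\<close> increases \<open>card Z\<close> by one and decreases the number of
components by one. So the terms of \<open>Z\<close> and \<open>insert e Z\<close> cancel.\<close>

lemma flow_poly_eq_0_if_single_edge_cut:
  assumes X: "X \<subseteq> verts G" "cut_edges G X = {e}"
  shows "flow_poly G = 0"
proof -
  have "flow_term G (insert e Z) = flow_term (delete_edge G e) Z"
    if Z: "Z \<subseteq> edges G - {e}" for Z
  proof -
    have "X \<in> unsplit_sets G Z" "splits (set_mset (ends G e)) X"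
      using X Z by (auto simp: unsplit_sets_def cut_edges_def)
    from num_components_insert_less[OF fin _ this] Z e
    have "num_components G Z = Suc (num_components G (insert e Z))" by auto
    then show ?thesis using card_insert_edge[OF Z] by (simp add: flow_term_def)
  qed
  then show ?thesis
    using flow_poly_split_edge[OF fin e]
    by (simp add: flow_poly_def flow_term_def[of "delete_edge G e"])
qed

text \<open>At \<open>1\<close> only the signs remain, and toggling \<open>e\<close> changes the sign.\<close>

lemma poly_flow_poly_1: "poly (flow_poly G) 1 = 0"
proof -
  have "poly (flow_term G (insert e Z)) 1 = poly (flow_term (delete_edge G e) Z) 1" if "Z \<subseteq> edges G - {e}" for Z
    using card_insert_edge[OF that] by (simp add: flow_term_def poly_monom)
  then show ?thesis
    using arg_cong[OF flow_poly_split_edge[OF fin e], of "\<lambda>p. poly p 1"]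
    by (simp add: flow_poly_def flow_term_def[of "delete_edge G e"] poly_sum)
qed

end

section \<open>Cuts, degrees and 2-edge-connectivity\<close>

text \<open>Stated by cuts, since a vertex set of a contracted graph has the same cut as its preimage.
This makes the property stable under contraction.\<close>

definition two_edge_connected :: "('v, 'e) multigraph \<Rightarrow> bool" where
  "two_edge_connected G \<longleftrightarrow>
     finite_multigraph G \<and> verts G \<noteq> {} \<and>
     (\<forall>X. X \<subset> verts G \<longrightarrow> X \<noteq> {} \<longrightarrow> 2 \<le> card (cut_edges G X))"

definition degree_three_verts :: "('v, 'e) multigraph \<Rightarrow> 'v set" where
  "degree_three_verts G = {v \<in> verts G. degree_at G v = 3}"

lemma finite_cut_edges: "finite_multigraph G \<Longrightarrow> finite (cut_edges G X)"
  by (simp add: finite_multigraph_def cut_edges_def)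

lemma finite_degree_three_verts: "finite_multigraph G \<Longrightarrow> finite (degree_three_verts G)"
  by (simp add: finite_multigraph_def degree_three_verts_def)

lemma cut_edges_delete: "cut_edges (delete_edge G e) X = cut_edges G X - {e}"
  by (auto simp: cut_edges_def)

lemma cut_edges_compl:
  assumes "finite_multigraph G"
  shows "cut_edges G (verts G - X) = cut_edges G X"
proof -
  have "splits (set_mset (ends G e)) (verts G - X) \<longleftrightarrow> splits (set_mset (ends G e)) X" if "e \<in> edges G" for e
  proof -
    have "set_mset (ends G e) \<subseteq> verts G" using assms that by (simp add: finite_multigraph_def)
    then show ?thesis unfolding splits_def by blast
  qed
  then show ?thesis unfolding cut_edges_def by blast
qed

lemma cut_edges_contract:
  assumes "ends G e = {#u, v#}" and "u \<noteq> v" and "v \<notin> X"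
  shows "cut_edges (contract_edge G e u v) X = cut_edges G ((id(v := u)) -` X)"
proof -
  have splits_contract: "splits (set_mset (ends (contract_edge G e u v) g)) X
      \<longleftrightarrow> splits (set_mset (ends G g)) ((id(v := u)) -` X)" for g
    by (simp only: contract_edge_simps set_image_mset splits_image)
  have "set_mset (ends G e) = {u, v}" using assms(1) by simp
  moreover have "u \<in> (id(v := u)) -` X \<longleftrightarrow> v \<in> (id(v := u)) -` X" using assms(2) by simp
  ultimately have not_split: "\<not> splits (set_mset (ends G e)) ((id(v := u)) -` X)"
    by (simp add: splits_def del: fun_upd_apply vimage_eq)
  show ?thesis
  proof (rule set_eqI)
    fix g
    show "g \<in> cut_edges (contract_edge G e u v) X \<longleftrightarrow> g \<in> cut_edges G ((id(v := u)) -` X)"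
    proof (cases "g = e")
      case True
      then show ?thesis using not_split by (simp add: cut_edges_def)
    next
      case False
      then show ?thesis unfolding cut_edges_def mem_Collect_eq splits_contract by simp
    qed
  qed
qed

lemma two_edge_connected_contract:
  assumes G: "two_edge_connected G" and e: "e \<in> edges G" "ends G e = {#u, v#}" "u \<noteq> v"
  shows "two_edge_connected (contract_edge G e u v)"
proof -
  have fin: "finite_multigraph G" using G by (simp add: two_edge_connected_def)
  have uv: "u \<in> verts G" "v \<in> verts G" using fin e by (auto simp: finite_multigraph_def)
  have "2 \<le> card (cut_edges (contract_edge G e u v) X)"
    if X: "X \<subset> verts G - {v}" "X \<noteq> {}" for X
  proof -
    let ?Y = "(id(v := u)) -` X"
    obtain x where x: "x \<in> X" using X(2) by blast
    obtain y where y: "y \<in> verts G" "y \<noteq> v" "y \<notin> X" using X(1) by blast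
    have "x \<noteq> v" using x X(1) by blast
    have "?Y \<subseteq> verts G"
    proof
      fix z assume "z \<in> ?Y"
      then show "z \<in> verts G" using uv X(1) by (cases "z = v") auto
    qed
    moreover have "x \<in> ?Y" "y \<notin> ?Y" using x y \<open>x \<noteq> v\<close> by simp_all
    ultimately have "?Y \<subset> verts G" "?Y \<noteq> {}" using y(1) by blast+
    then have "2 \<le> card (cut_edges G ?Y)" using G by (simp add: two_edge_connected_def)
    moreover have "v \<notin> X" using X(1) by blast
    ultimately show ?thesis using cut_edges_contract[OF e(2,3), of X] by simp
  qed
  moreover have "verts G - {v} \<noteq> {}" using uv e(3) by blast
  ultimately show ?thesis
    using finite_multigraph_contract[OF fin uv(1) e(3)]
    by (simp add: two_edge_connected_def)
qed

lemma two_edge_connected_delete_loop: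
  assumes "two_edge_connected G" "ends G e = {#v, v#}"
  shows "two_edge_connected (delete_edge G e)"
proof -
  have "cut_edges G X - {e} = cut_edges G X" for X
    using assms(2) by (auto simp: cut_edges_def splits_def)
  then show ?thesis
    using assms(1) finite_multigraph_delete[of G e]
    by (simp add: two_edge_connected_def cut_edges_delete)
qed

lemma card_cut_edges_submodular:
  assumes "finite_multigraph G"
  shows "card (cut_edges G (X \<inter> Y)) + card (cut_edges G (X \<union> Y))
           \<le> card (cut_edges G X) + card (cut_edges G Y)"
proof -
  let ?c = "cut_edges G"
  note [simp] = finite_cut_edges[OF assms]
  have "card (?c (X \<inter> Y)) + card (?c (X \<union> Y))
      = card (?c (X \<inter> Y) \<union> ?c (X \<union> Y)) + card (?c (X \<inter> Y) \<inter> ?c (X \<union> Y))"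
    by (rule card_Un_Int) simp_all
  also have "\<dots> \<le> card (?c X \<union> ?c Y) + card (?c X \<inter> ?c Y)"
  proof (intro add_mono card_mono)
    show "?c (X \<inter> Y) \<union> ?c (X \<union> Y) \<subseteq> ?c X \<union> ?c Y"
      "?c (X \<inter> Y) \<inter> ?c (X \<union> Y) \<subseteq> ?c X \<inter> ?c Y"
      by (auto simp: cut_edges_def splits_def)
  qed simp_all
  also have "\<dots> = card (?c X) + card (?c Y)"
    by (rule card_Un_Int[symmetric]) simp_all
  finally show ?thesis .
qed

text \<open>Each edge at \<open>v\<close> is a loop or leaves \<open>{v}\<close>.\<close>

lemma degree_at_eq:
  assumes fin: "finite_multigraph G"
  shows "degree_at G v = card (cut_edges G {v}) + 2 * card {e \<in> edges G. ends G e = {#v, v#}}"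
proof -
  have finE: "finite (edges G)" using fin by (simp add: finite_multigraph_def)
  have count_edges: "(\<Sum>e\<in>edges G. if P e then 1 else 0) = card {e \<in> edges G. P e}" for P
    using sum.inter_filter[OF finE, of "\<lambda>_. 1::nat" P] by simp
  have "count (ends G e) v = (if splits (set_mset (ends G e)) {v} then 1 else 0)
          + 2 * (if ends G e = {#v, v#} then 1 else 0)" if "e \<in> edges G" for e
  proof -
    obtain a b where ab: "ends G e = {#a, b#}" using ends_cases[OF fin \<open>e \<in> edges G\<close>] .
    have "ends G e = {#v, v#} \<longleftrightarrow> a = v \<and> b = v"
      unfolding ab by (auto dest: arg_cong[where f = set_mset])
    moreover have "splits (set_mset (ends G e)) {v} \<longleftrightarrow> (a = v) \<noteq> (b = v)"
      unfolding ab splits_def by auto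
    ultimately show ?thesis by (cases "a = v"; cases "b = v") (simp_all add: ab)
  qed
  then have "degree_at G v = (\<Sum>e\<in>edges G. (if splits (set_mset (ends G e)) {v} then 1 else 0)
          + 2 * (if ends G e = {#v, v#} then 1 else 0))"
    unfolding degree_at_def by (intro sum.cong) auto
  also have "\<dots> = card (cut_edges G {v}) + 2 * card {e \<in> edges G. ends G e = {#v, v#}}"
    by (simp only: sum.distrib sum_distrib_left[symmetric] count_edges cut_edges_def)
  finally show ?thesis .
qed

lemma degree_at_delete:
  assumes "finite_multigraph G" "e \<in> edges G"
  shows "degree_at G w = degree_at (delete_edge G e) w + count (ends G e) w"
  using assms sum.remove[of "edges G" e "\<lambda>g. count (ends G g) w"]
  by (simp add: degree_at_def finite_multigraph_def)

lemma count_image_mset_merge: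
  assumes "u \<noteq> v"
  shows "count (image_mset (id(v := u)) M) w
           = (if w = u then count M u + count M v else if w = v then 0 else count M w)"
  using assms by (induction M) auto

lemma degree_at_contract:
  assumes G: "finite_multigraph G" "e \<in> edges G" and e: "ends G e = {#u, v#}" "u \<noteq> v"
  shows "degree_at (contract_edge G e u v) u + 2 = degree_at G u + degree_at G v"
    and "\<lbrakk>w \<noteq> u; w \<noteq> v\<rbrakk> \<Longrightarrow> degree_at (contract_edge G e u v) w = degree_at G w"
proof -
  have contract: "degree_at (contract_edge G e u v) x
      = (\<Sum>g\<in>edges G - {e}. if x = u then count (ends G g) u + count (ends G g) v
           else if x = v then 0 else count (ends G g) x)" for x
    by (simp only: degree_at_def contract_edge_simps count_image_mset_merge[OF e(2)])
  have delete: "degree_at G x = (\<Sum>g\<in>edges G - {e}. count (ends G g) x) + count (ends G e) x" for x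
    using degree_at_delete[OF G, of x] by (simp only: degree_at_def delete_edge_simps)
  show "degree_at (contract_edge G e u v) u + 2 = degree_at G u + degree_at G v"
    unfolding contract delete using e by (simp add: sum.distrib)
  show "degree_at (contract_edge G e u v) w = degree_at G w" if "w \<noteq> u" "w \<noteq> v"
    unfolding contract delete using e that by simp
qed

text \<open>If no edge can be deleted, then every edge lies in a cut with two edges. Take a side \<open>X\<close> of such a cut
with as few vertices as possible. If an edge had both ends in \<open>X\<close>, then a two-edge cut containing it would cross
\<open>X\<close>, and by submodularity one of the corners would be a smaller side. So no edge lies inside \<open>X\<close>, and
as at least two edges leave each single vertex while only two edges leave \<open>X\<close>, the set \<open>X\<close> is a single
vertex, whose degree is two.\<close>

lemma removable_edge_or_degree_two:
  assumes G: "two_edge_connected G" and ne: "edges G \<noteq> {}"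
    and loopless: "\<And>e v. e \<in> edges G \<Longrightarrow> ends G e \<noteq> {#v, v#}"
    and not_removable: "\<And>e. e \<in> edges G \<Longrightarrow> \<not> two_edge_connected (delete_edge G e)"
  shows "\<exists>v\<in>verts G. degree_at G v = 2"
proof -
  have fin: "finite_multigraph G" and V: "verts G \<noteq> {}"
    and cut: "\<And>X. \<lbrakk>X \<subset> verts G; X \<noteq> {}\<rbrakk> \<Longrightarrow> 2 \<le> card (cut_edges G X)"
    using G by (auto simp: two_edge_connected_def)
  define tight where "tight X \<longleftrightarrow> X \<subset> verts G \<and> X \<noteq> {} \<and> card (cut_edges G X) = 2" for X
  have ex_tight: "\<exists>X. tight X \<and> splits (set_mset (ends G e)) X" if e: "e \<in> edges G" for e
  proof -
    obtain X where X: "X \<subset> verts G" "X \<noteq> {}" "card (cut_edges G X - {e}) < 2"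
      using not_removable[OF e] fin V finite_multigraph_delete[of G e]
      by (auto simp: two_edge_connected_def cut_edges_delete not_le)
    have "2 \<le> card (cut_edges G X)" by (rule cut[OF X(1,2)])
    with X(3) have e_cut: "e \<in> cut_edges G X" by (cases "e \<in> cut_edges G X") simp_all
    with X(3) \<open>2 \<le> card (cut_edges G X)\<close> have "card (cut_edges G X) = 2"
      using card.remove[OF finite_cut_edges[OF fin] e_cut] by linarith
    with X(1,2) e_cut show ?thesis by (auto simp: tight_def cut_edges_def)
  qed
  then obtain X0 where "tight X0" using ne by blast
  then obtain X where X: "tight X" and min: "\<And>Y. tight Y \<Longrightarrow> card X \<le> card Y"
    using ex_has_least_nat[of tight X0 card] by blast
  have X': "X \<subset> verts G" "X \<noteq> {}" "card (cut_edges G X) = 2" using X by (auto simp: tight_def)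
  have "finite X" using X'(1) fin finite_subset by (auto simp: finite_multigraph_def)
  have no_cross: False
    if e: "set_mset (ends G e) \<subseteq> X" and Y: "tight Y" "splits (set_mset (ends G e)) Y"
      and "X \<union> Y \<noteq> verts G" for e Y
  proof -
    have sub: "X \<inter> Y \<subset> verts G" "X \<inter> Y \<noteq> {}" "X \<inter> Y \<subset> X" "X \<union> Y \<subset> verts G" "X \<union> Y \<noteq> {}"
      using X'(1,2) Y e \<open>X \<union> Y \<noteq> verts G\<close> unfolding tight_def splits_def by blast+
    have "card (cut_edges G (X \<inter> Y)) + card (cut_edges G (X \<union> Y)) \<le> 2 + 2"
      using card_cut_edges_submodular[OF fin, of X Y] X'(3) Y(1) by (simp add: tight_def)
    then have "tight (X \<inter> Y)"
      using cut[OF sub(1,2)] cut[OF sub(4,5)] sub(1,2) by (simp add: tight_def)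
    then show False using min[of "X \<inter> Y"] psubset_card_mono[OF \<open>finite X\<close> sub(3)] by simp
  qed
  have no_inner: "\<not> set_mset (ends G e) \<subseteq> X" if e: "e \<in> edges G" for e
  proof
    assume inX: "set_mset (ends G e) \<subseteq> X"
    obtain Y where Y: "tight Y" "splits (set_mset (ends G e)) Y" using ex_tight[OF e] by blast
    \<comment> \<open>As \<open>X\<close> is proper, it cannot cover all vertices together with \<open>Y\<close> and also with its complement.\<close>
    have "verts G - Y \<subset> verts G" "verts G - Y \<noteq> {}" using Y(1) unfolding tight_def by blast+
    then have "tight (verts G - Y)" using Y(1) cut_edges_compl[OF fin, of Y] by (simp add: tight_def)
    moreover have "splits (set_mset (ends G e)) (verts G - Y)"
      using Y(2) inX X'(1) unfolding splits_def by blast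
    ultimately show False
      using no_cross[OF inX Y] no_cross[OF inX, of "verts G - Y"] X'(1) by blast
  qed
  have "X = {x}" if x: "x \<in> X" for x
  proof (rule ccontr)
    assume "X \<noteq> {x}"
    then obtain y where y: "y \<in> X" "y \<noteq> x" using x by blast
    have "cut_edges G {x} \<inter> cut_edges G {y} = {}"
    proof (rule ccontr)
      assume "cut_edges G {x} \<inter> cut_edges G {y} \<noteq> {}"
      then obtain e where e: "e \<in> edges G" "x \<in># ends G e" "y \<in># ends G e"
        by (auto simp: cut_edges_def splits_def)
      obtain a b where "ends G e = {#a, b#}" using ends_cases[OF fin e(1)] .
      then have "set_mset (ends G e) = {x, y}" using e(2,3) y(2) by auto
      then have "set_mset (ends G e) \<subseteq> X" using x y(1) by simp
      then show False using no_inner e(1) by blast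
    qed
    then have "card (cut_edges G {x}) + card (cut_edges G {y})
        = card (cut_edges G {x} \<union> cut_edges G {y})"
      by (simp add: card_Un_disjoint finite_cut_edges[OF fin])
    also have "\<dots> \<le> card (cut_edges G X)"
    proof (rule card_mono[OF finite_cut_edges[OF fin]])
      show "cut_edges G {x} \<union> cut_edges G {y} \<subseteq> cut_edges G X"
        using no_inner x y(1) unfolding cut_edges_def splits_def by blast
    qed
    finally have "card (cut_edges G {x}) + card (cut_edges G {y}) \<le> 2" using X'(3) by simp
    moreover have "{x} \<subset> verts G" "{y} \<subset> verts G" using x y X'(1) by auto
    ultimately show False using cut[of "{x}"] cut[of "{y}"] by simp
  qed
  then obtain x where "X = {x}" using X'(2) by blast
  moreover have "{e \<in> edges G. ends G e = {#x, x#}} = {}" using loopless by blast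
  then have "card {e \<in> edges G. ends G e = {#x, x#}} = 0" by (simp only: card.empty)
  then have "degree_at G x = card (cut_edges G {x})" using degree_at_eq[OF fin, of x] by simp
  ultimately have "x \<in> verts G" "degree_at G x = 2" using X' by auto
  then show ?thesis by blast
qed

section \<open>Polynomials with positive real roots\<close>

lemma coeff_prod_linear:
  fixes r :: "'i \<Rightarrow> 'a::comm_ring_1"
  assumes "finite I"
  shows "coeff (\<Prod>i\<in>I. [:r i, 1:]) k = (\<Sum>S | S \<subseteq> I \<and> card (I - S) = k. \<Prod>i\<in>S. r i)"
proof -
  have "(\<Prod>i\<in>I. [:r i, 1:]) = (\<Prod>i\<in>I. [:r i:] + [:0, 1:])" by simp
  also have "\<dots> = (\<Sum>S\<in>Pow I. (\<Prod>i\<in>S. [:r i:]) * (\<Prod>i\<in>I - S. [:0, 1:]))"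
    by (rule prod_add[OF assms])
  also have "\<dots> = (\<Sum>S\<in>Pow I. monom (\<Prod>i\<in>S. r i) (card (I - S)))"
  proof (rule sum.cong)
    fix S
    have "(\<Prod>i\<in>S. [:r i:]) = [:\<Prod>i\<in>S. r i:]"
      by (induction S rule: infinite_finite_induct) (auto simp: one_pCons)
    moreover have "[:0, 1:] ^ n = monom (1::'a) n" for n
      by (simp add: monom_altdef)
    ultimately show "(\<Prod>i\<in>S. [:r i:]) * (\<Prod>i\<in>I - S. [:0, 1:]) = monom (\<Prod>i\<in>S. r i) (card (I - S))"
      by (simp add: smult_monom)
  qed simp
  also have "coeff \<dots> k = (\<Sum>S\<in>Pow I. if card (I - S) = k then \<Prod>i\<in>S. r i else 0)"
    by (simp add: coeff_sum)
  also have "\<dots> = (\<Sum>S | S \<subseteq> I \<and> card (I - S) = k. \<Prod>i\<in>S. r i)"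
    using assms by (subst sum.inter_filter[symmetric]) (auto intro: sum.cong)
  finally show ?thesis .
qed

text \<open>Double counting: an index lies in \<open>(card I - 1) choose j\<close> of these sets.\<close>

lemma sum_subsets_sum_indices:
  fixes x :: "'i \<Rightarrow> 'a::comm_semiring_1"
  assumes "finite I"
  shows "(\<Sum>S | S \<subseteq> I \<and> card S = Suc j. \<Sum>i\<in>S. x i) = of_nat ((card I - 1) choose j) * (\<Sum>i\<in>I. x i)"
proof -
  let ?A = "{S. S \<subseteq> I \<and> card S = Suc j}"
  have finA: "finite ?A" using assms by simp
  have "(\<Sum>S\<in>?A. \<Sum>i\<in>S. x i) = (\<Sum>S\<in>?A. \<Sum>i | i \<in> I \<and> i \<in> S. x i)"
    by (intro sum.cong) auto
  also have "\<dots> = (\<Sum>i\<in>I. \<Sum>S | S \<in> ?A \<and> i \<in> S. x i)"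
    by (rule sum.swap_restrict[OF finA assms])
  also have "\<dots> = (\<Sum>i\<in>I. of_nat ((card I - 1) choose j) * x i)"
  proof (rule sum.cong)
    fix i assume i: "i \<in> I"
    have "bij_betw (insert i) {T. T \<subseteq> I - {i} \<and> card T = j} {S. S \<in> ?A \<and> i \<in> S}"
    proof (rule bij_betw_byWitness[where f' = "\<lambda>S. S - {i}"])
      show "insert i ` {T. T \<subseteq> I - {i} \<and> card T = j} \<subseteq> {S \<in> ?A. i \<in> S}"
      proof (rule image_subsetI)
        fix T assume T: "T \<in> {T. T \<subseteq> I - {i} \<and> card T = j}"
        then have "finite T" "i \<notin> T" using finite_subset[of T I] assms by blast+
        with T i show "insert i T \<in> {S \<in> ?A. i \<in> S}" by auto
      qed
      show "(\<lambda>S. S - {i}) ` {S \<in> ?A. i \<in> S} \<subseteq> {T. T \<subseteq> I - {i} \<and> card T = j}"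
        using assms by (auto simp: card_Diff_singleton)
    qed auto
    then have "card {T. T \<subseteq> I - {i} \<and> card T = j} = card {S. S \<in> ?A \<and> i \<in> S}"
      by (rule bij_betw_same_card)
    moreover have "card {T. T \<subseteq> I - {i} \<and> card T = j} = (card I - 1) choose j"
      using assms i by (simp add: n_subsets card_Diff_singleton)
    ultimately show "(\<Sum>S | S \<in> ?A \<and> i \<in> S. x i) = of_nat ((card I - 1) choose j) * x i" by simp
  qed simp
  finally show ?thesis by (simp add: sum_distrib_left)
qed

text \<open>With \<open>r i = c * exp (x i)\<close>, the coefficient on the right is a sum over index sets \<open>S\<close> of one size \<open>j\<close>
of \<open>c ^ j * exp (sum x S)\<close>, and each exponential is at least \<open>1 + sum x S\<close>. The linear parts add up to
a nonnegative multiple of the sum of all \<open>x i\<close>, which is nonnegative by the assumption on the product.\<close>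

lemma coeff_prod_linear_ge:
  fixes r :: "'i \<Rightarrow> real"
  assumes fin: "finite I" and pos: "\<And>i. i \<in> I \<Longrightarrow> r i > 0"
    and c: "c > 0" "c ^ card I \<le> (\<Prod>i\<in>I. r i)"
  shows "coeff ([:c, 1:] ^ card I) k \<le> coeff (\<Prod>i\<in>I. [:r i, 1:]) k"
proof -
  define x where "x i = ln (r i / c)" for i
  have r_exp: "r i = c * exp (x i)" if "i \<in> I" for i
    using pos[OF that] c(1) by (simp add: x_def)
  have "(\<Prod>i\<in>I. r i) = (\<Prod>i\<in>I. c * exp (x i))" using r_exp by (intro prod.cong) auto
  also have "\<dots> = c ^ card I * exp (\<Sum>i\<in>I. x i)"
    using fin by (simp add: prod.distrib exp_sum)
  finally have "exp (\<Sum>i\<in>I. x i) \<ge> 1" using c by (simp add: mult_le_cancel_left1)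
  then have x_nonneg: "(\<Sum>i\<in>I. x i) \<ge> 0" by simp
  let ?A = "{S. S \<subseteq> I \<and> card (I - S) = k}"
  have finA: "finite ?A" using fin by simp
  have finS: "finite S" if "S \<in> ?A" for S using that fin finite_subset by auto
  have cardS: "card S = card I - k" if "S \<in> ?A" for S
    using that fin card_Diff_subset[OF finS[OF that], of I] card_mono[OF fin, of S] by auto
  \<comment> \<open>For \<open>k \<ge> card I\<close> the only possible index set is empty, and the counting lemma for nonempty index
    sets does not apply.\<close>
  have "(\<Sum>S\<in>?A. \<Sum>i\<in>S. x i) \<ge> 0"
  proof (cases "k < card I")
    case True
    have "?A = {S. S \<subseteq> I \<and> card S = Suc (card I - k - 1)}"
    proof (intro Collect_cong conj_cong refl)
      fix S assume "S \<subseteq> I"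
      then have "card (I - S) = card I - card S" "card S \<le> card I"
        using fin card_mono[OF fin] card_Diff_subset[OF finite_subset[OF _ fin]] by blast+
      then show "card (I - S) = k \<longleftrightarrow> card S = Suc (card I - k - 1)" using True by auto
    qed
    with x_nonneg show ?thesis by (simp add: sum_subsets_sum_indices[OF fin])
  next
    case False
    then have "S = {}" if "S \<in> ?A" for S using cardS[OF that] finS[OF that] by simp
    then show ?thesis by (intro sum_nonneg) auto
  qed
  then have "(\<Sum>S\<in>?A. c ^ (card I - k) * 1) \<le> c ^ (card I - k) * (\<Sum>S\<in>?A. 1 + (\<Sum>i\<in>S. x i))"
    using c(1) by (simp add: sum.distrib algebra_simps)
  also have "\<dots> = (\<Sum>S\<in>?A. c ^ (card I - k) * (1 + (\<Sum>i\<in>S. x i)))"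
    by (simp add: sum_distrib_left)
  also have "\<dots> \<le> (\<Sum>S\<in>?A. \<Prod>i\<in>S. r i)"
  proof (rule sum_mono)
    fix S assume S: "S \<in> ?A"
    have "(\<Prod>i\<in>S. r i) = (\<Prod>i\<in>S. c * exp (x i))" using r_exp S by (intro prod.cong) auto
    also have "\<dots> = c ^ (card I - k) * exp (\<Sum>i\<in>S. x i)"
      using finS[OF S] cardS[OF S] by (simp add: prod.distrib exp_sum)
    finally show "c ^ (card I - k) * (1 + (\<Sum>i\<in>S. x i)) \<le> (\<Prod>i\<in>S. r i)"
      using c(1) by simp
  qed
  also have "(\<Sum>S\<in>?A. c ^ (card I - k) * 1) = (\<Sum>S\<in>?A. \<Prod>i\<in>S. c)"
    using cardS by (intro sum.cong) auto
  finally have "(\<Sum>S\<in>?A. \<Prod>i\<in>S. c) \<le> (\<Sum>S\<in>?A. \<Prod>i\<in>S. r i)" .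
  then show ?thesis
    using coeff_prod_linear[OF fin, of "\<lambda>_. c" k] coeff_prod_linear[OF fin, of r k] by simp
qed

text \<open>All products that contribute to one coefficient have the same number of factors, hence the same sign.\<close>

lemma coeff_prod_linear_abs:
  fixes r :: "'i \<Rightarrow> real"
  assumes fin: "finite I" and pos: "\<And>i. i \<in> I \<Longrightarrow> r i > 0"
  shows "\<bar>coeff (\<Prod>i\<in>I. [:- r i, 1:]) k\<bar> = coeff (\<Prod>i\<in>I. [:r i, 1:]) k"
proof -
  let ?A = "{S. S \<subseteq> I \<and> card (I - S) = k}"
  have "(\<Prod>i\<in>S. - r i) = (-1) ^ (card I - k) * (\<Prod>i\<in>S. r i)" if S: "S \<in> ?A" for S
  proof -
    have "finite S" "card S \<le> card I" using S fin finite_subset by (auto intro: card_mono)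
    then have "card S = card I - k" using S fin by (auto simp: card_Diff_subset)
    then show ?thesis using prod_uminus[of r S] by simp
  qed
  then have "coeff (\<Prod>i\<in>I. [:- r i, 1:]) k = (-1) ^ (card I - k) * coeff (\<Prod>i\<in>I. [:r i, 1:]) k"
    using coeff_prod_linear[OF fin, of "\<lambda>i. - r i" k] coeff_prod_linear[OF fin, of r k]
    by (simp add: sum_distrib_left)
  moreover have "coeff (\<Prod>i\<in>I. [:r i, 1:]) k \<ge> 0"
    unfolding coeff_prod_linear[OF fin] using pos
    by (intro sum_nonneg prod_nonneg) (auto intro: less_imp_le)
  ultimately show ?thesis by (simp add: abs_mult)
qed

lemma map_poly_of_real_mult:
  "map_poly of_real (p * q) = map_poly of_real p * (map_poly of_real q :: 'a::{real_algebra_1,comm_ring_1} poly)"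
  by (rule poly_eqI) (simp add: coeff_map_poly coeff_mult)

lemma poly_map_poly_of_real: "poly (map_poly of_real p) (of_real x) = (of_real (poly p x) :: complex)"
  by (induction p) (simp_all add: map_poly_pCons)

lemma map_poly_of_int_mult:
  "map_poly of_int (p * q) = map_poly of_int p * (map_poly of_int q :: 'a::comm_ring_1 poly)"
  by (rule poly_eqI) (simp add: coeff_map_poly coeff_mult)

lemma map_poly_of_int_diff:
  "map_poly of_int (p - q) = map_poly of_int p - (map_poly of_int q :: 'a::ring_1 poly)"
  by (rule poly_eqI) (simp add: coeff_map_poly)

lemma poly_map_poly_of_int: "poly (map_poly of_int p) (of_int x) = (of_int (poly p x) :: 'a::comm_ring_1)"
  by (induction p) (simp_all add: map_poly_pCons)

lemma monic_real_rooted_factorization: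
  fixes p :: "real poly"
  assumes "lead_coeff p = 1"
    and "\<And>z. poly (map_poly complex_of_real p) z = 0 \<Longrightarrow> z \<in> \<real>"
  shows "\<exists>r. p = (\<Prod>i<degree p. [:- r i, 1:])"
  using assms
proof (induction "degree p" arbitrary: p)
  case 0
  then show ?case by (auto elim: degree_eq_zeroE simp: one_pCons)
next
  case (Suc d)
  let ?q = "map_poly complex_of_real p"
  have "degree ?q = degree p" by (simp add: degree_map_poly)
  then have "\<not> constant (poly ?q)" using Suc.hyps(2) by (simp add: constant_degree)
  then obtain z where "poly ?q z = 0" using fundamental_theorem_of_algebra by blast
  then obtain x where "z = of_real x" using Suc.prems(2) Reals_cases by blast
  then have "poly p x = 0" using \<open>poly ?q z = 0\<close> by (simp add: poly_map_poly_of_real)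
  then obtain q where q: "p = [:- x, 1:] * q" by (auto simp: poly_eq_0_iff_dvd)
  then have "q \<noteq> 0" using Suc.prems(1) by auto
  then have "degree p = Suc (degree q)" unfolding q by (subst degree_mult_eq) auto
  moreover have "lead_coeff q = 1" using Suc.prems(1) unfolding q lead_coeff_mult by simp
  moreover have "z \<in> \<real>" if "poly (map_poly complex_of_real q) z = 0" for z
    using that Suc.prems(2)[of z] unfolding q map_poly_of_real_mult by simp
  ultimately obtain r where "q = (\<Prod>i<degree q. [:- r i, 1:])" "degree q = d"
    using Suc.hyps by auto
  then have "p = (\<Prod>i<degree p. [:- (r(d := x)) i, 1:])"
    using q Suc.hyps(2)[symmetric] by (simp add: mult.commute)
  then show ?case by blast
qed

section \<open>A lower bound for the flow polynomial at nonpositive arguments\<close>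

text \<open>The exponent of the sign has the parity of \<open>card (edges G) - card (verts G) + 1\<close>, the nullity of a
connected graph. This sign turns deletion and contraction into a sum of nonnegative terms for \<open>t \<le> 0\<close>.\<close>

definition signed_flow :: "('v, 'e) multigraph \<Rightarrow> real \<Rightarrow> real" where
  "signed_flow G t = (-1) ^ (card (edges G) + card (verts G) + 1) * poly (map_poly of_int (flow_poly G)) t"

lemma signed_flow_deletion_contraction:
  assumes fin: "finite_multigraph G" and e: "e \<in> edges G" "ends G e = {#u, v#}" "u \<noteq> v"
  shows "signed_flow G t = signed_flow (contract_edge G e u v) t + signed_flow (delete_edge G e) t"
proof -
  have "finite (edges G)" "finite (verts G)" "v \<in> verts G"
    using fin e by (auto simp: finite_multigraph_def)
  note card.remove[OF this(1) e(1)] card.remove[OF this(2,3)]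
  then show ?thesis
    unfolding signed_flow_def flow_poly_deletion_contraction[OF fin e]
    by (simp add: map_poly_of_int_diff algebra_simps)
qed

lemma signed_flow_loop:
  assumes fin: "finite_multigraph G" and e: "e \<in> edges G" "ends G e = {#v, v#}"
  shows "signed_flow G t = (1 - t) * signed_flow (delete_edge G e) t"
proof -
  have "card (edges G) = Suc (card (edges G - {e}))"
    using e(1) fin by (intro card.remove) (simp_all add: finite_multigraph_def)
  moreover have "map_poly of_int [:-1, 1:] = [:-1, 1::real:]" by (simp add: map_poly_pCons)
  ultimately show ?thesis
    using flow_poly_loop[OF fin e]
    by (simp only: signed_flow_def map_poly_of_int_mult) (simp add: algebra_simps)
qed

text \<open>Either the remaining graph is still 2-edge-connected, or it has a bridge and its flow polynomial
vanishes.\<close>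

lemma signed_flow_delete_nonneg:
  assumes G: "two_edge_connected G" and e: "e \<in> edges G"
    and IH: "two_edge_connected (delete_edge G e) \<Longrightarrow> 0 \<le> signed_flow (delete_edge G e) t"
  shows "0 \<le> signed_flow (delete_edge G e) t"
proof (cases "two_edge_connected (delete_edge G e)")
  case False
  have fin: "finite_multigraph G" and V: "verts G \<noteq> {}"
    and cut: "\<And>X. \<lbrakk>X \<subset> verts G; X \<noteq> {}\<rbrakk> \<Longrightarrow> 2 \<le> card (cut_edges G X)"
    using G by (auto simp: two_edge_connected_def)
  obtain X where X: "X \<subset> verts G" "X \<noteq> {}" "card (cut_edges G X - {e}) < 2"
    using False fin V finite_multigraph_delete[of G e]
    by (auto simp: two_edge_connected_def cut_edges_delete not_le)
  have "card (cut_edges G X - {e}) = 1"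
    using X(3) cut[OF X(1,2)] finite_cut_edges[OF fin, of X]
    by (auto simp: card_Diff_singleton_if split: if_splits)
  then obtain g where g: "cut_edges (delete_edge G e) X = {g}"
    by (auto simp: card_1_singleton_iff cut_edges_delete)
  then have "g \<in> edges (delete_edge G e)" by (auto simp: cut_edges_def)
  then have "flow_poly (delete_edge G e) = 0"
    using X(1) g by (intro flow_poly_eq_0_if_single_edge_cut[OF finite_multigraph_delete[OF fin]]) auto
  then show ?thesis by (simp add: signed_flow_def)
qed (rule IH)

text \<open>The induction needs graphs with arbitrary degrees, since contraction leaves the class of cubic
graphs, so the bound counts the vertices of degree three. If an edge can be deleted without losing
2-edge-connectivity, then contraction and deletion each destroy at most its two ends as vertices of
degree three, so each contributes at least \<open>sqrt 2 ^ (k - 2)\<close>, and twice this number is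
\<open>sqrt 2 ^ k\<close>. Otherwise there is a vertex of degree two, and contracting an edge at such a
vertex changes no other degree. A loop contributes the factor \<open>1 - t \<ge> 1\<close>, and it cannot sit at a
vertex of degree three, as the third edge at this vertex would be a bridge.\<close>

theorem signed_flow_ge:
  fixes G :: "('v, 'e) multigraph"
  assumes "two_edge_connected G" and t: "t \<le> 0"
  shows "sqrt 2 ^ card (degree_three_verts G) \<le> signed_flow G t"
  using assms(1)
proof (induction "card (edges G)" arbitrary: G rule: less_induct)
  case less
  let ?k = "card (degree_three_verts G)"
  have fin: "finite_multigraph G" and V: "verts G \<noteq> {}"
    and cut: "\<And>X. \<lbrakk>X \<subset> verts G; X \<noteq> {}\<rbrakk> \<Longrightarrow> 2 \<le> card (cut_edges G X)"
    using less.prems by (auto simp: two_edge_connected_def)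
  have finE: "finite (edges G)" and finV: "finite (verts G)"
    using fin by (auto simp: finite_multigraph_def)
  have smaller: "card (edges G - {e}) < card (edges G)" if "e \<in> edges G" for e
    using finE that by (rule card_Diff1_less)
  have IH_delete: "sqrt 2 ^ card (degree_three_verts (delete_edge G e)) \<le> signed_flow (delete_edge G e) t"
    if "e \<in> edges G" "two_edge_connected (delete_edge G e)" for e
    using less.hyps[of "delete_edge G e"] smaller that by simp
  have IH_contract: "sqrt 2 ^ card (degree_three_verts (contract_edge G e u v)) \<le> signed_flow (contract_edge G e u v) t"
    if "e \<in> edges G" "ends G e = {#u, v#}" "u \<noteq> v" for e u v
    using less.hyps[of "contract_edge G e u v"] smaller[OF that(1)]
      two_edge_connected_contract[OF less.prems that] by simp
  have mono: "sqrt 2 ^ a \<le> sqrt 2 ^ b" if "a \<le> b" for a b :: nat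
    using that by (intro power_increasing) auto
  consider (empty) "edges G = {}" | (loop) e v where "e \<in> edges G" "ends G e = {#v, v#}"
    | (loopless) "edges G \<noteq> {}" "\<And>e v. e \<in> edges G \<Longrightarrow> ends G e \<noteq> {#v, v#}" by blast
  then show ?case
  proof cases
    case empty
    obtain v where v: "v \<in> verts G" using V by blast
    have "verts G = {v}"
    proof (rule ccontr)
      assume "verts G \<noteq> {v}"
      then have "{v} \<subset> verts G" using v by auto
      then show False using cut[of "{v}"] empty by (simp add: cut_edges_def)
    qed
    moreover from this have "2 ^ num_components G {} = (2::nat) ^ 1"
      using two_power_num_components[OF fin, of "{}"]
      by (simp add: unsplit_sets_def card_Pow flip: Pow_def)
    then have "num_components G {} = 1" by (subst (asm) power_inject_exp) simp_all
    ultimately have "signed_flow G t = 1"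
      using empty by (simp add: signed_flow_def flow_poly_def monom_0 map_poly_pCons one_pCons)
    moreover have "degree_three_verts G = {}"
      using empty by (simp add: degree_three_verts_def degree_at_def)
    ultimately show ?thesis by simp
  next
    case (loop e v)
    have not3: "degree_at G v \<noteq> 3"
    proof
      assume "degree_at G v = 3"
      moreover note degree_at_eq[OF fin, of v]
      moreover have "{e \<in> edges G. ends G e = {#v, v#}} \<noteq> {}" using loop by blast
      then have "card {e \<in> edges G. ends G e = {#v, v#}} \<noteq> 0" using finE by simp
      ultimately have one: "card (cut_edges G {v}) = 1" by arith
      have "v \<in> verts G" using fin loop by (auto simp: finite_multigraph_def)
      show False
      proof (cases "verts G = {v}")
        case True
        then have "cut_edges G {v} = {}"
          using fin by (auto simp: cut_edges_def splits_def finite_multigraph_def)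
        then show False using one by simp
      next
        case False
        then have "{v} \<subset> verts G" using \<open>v \<in> verts G\<close> by auto
        then show False using cut[of "{v}"] one by simp
      qed
    qed
    have "degree_three_verts G \<subseteq> degree_three_verts (delete_edge G e)"
    proof
      fix w assume w: "w \<in> degree_three_verts G"
      then have "w \<noteq> v" using not3 by (auto simp: degree_three_verts_def)
      then show "w \<in> degree_three_verts (delete_edge G e)"
        using w degree_at_delete[OF fin loop(1), of w] by (simp add: degree_three_verts_def loop(2))
    qed
    then have "?k \<le> card (degree_three_verts (delete_edge G e))"
      by (intro card_mono finite_degree_three_verts finite_multigraph_delete fin)
    then have "sqrt 2 ^ ?k \<le> sqrt 2 ^ card (degree_three_verts (delete_edge G e))" by (rule mono)
    also have "\<dots> \<le> signed_flow (delete_edge G e) t"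
      by (rule IH_delete[OF loop(1) two_edge_connected_delete_loop[OF less.prems loop(2)]])
    finally have ge: "sqrt 2 ^ ?k \<le> signed_flow (delete_edge G e) t" .
    have "0 \<le> signed_flow (delete_edge G e) t" by (rule order_trans[OF _ ge]) simp
    then have "1 * signed_flow (delete_edge G e) t \<le> (1 - t) * signed_flow (delete_edge G e) t"
      using t by (intro mult_right_mono) simp_all
    with ge show ?thesis using signed_flow_loop[OF fin loop] by simp
  next
    case loopless
    show ?thesis
    proof (cases "\<exists>e\<in>edges G. two_edge_connected (delete_edge G e)")
      case True
      then obtain e where e: "e \<in> edges G" and del: "two_edge_connected (delete_edge G e)" by blast
      obtain u v where uv: "ends G e = {#u, v#}" using ends_cases[OF fin e] .
      with loopless(2)[OF e] have "u \<noteq> v" by blast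
      have drop: "?k - 2 \<le> card (degree_three_verts H)"
        if "finite_multigraph H" "degree_three_verts G - {u, v} \<subseteq> degree_three_verts H"
        for H :: "('v, 'e) multigraph"
      proof -
        have "?k - 2 \<le> card (degree_three_verts G - {u, v})"
          using diff_card_le_card_Diff[of "{u, v}" "degree_three_verts G"] \<open>u \<noteq> v\<close> by simp
        also have "\<dots> \<le> card (degree_three_verts H)"
          using that by (intro card_mono finite_degree_three_verts)
        finally show ?thesis .
      qed
      have "degree_three_verts G - {u, v} \<subseteq> degree_three_verts (delete_edge G e)"
        using degree_at_delete[OF fin e] by (auto simp: degree_three_verts_def uv)
      then have "sqrt 2 ^ (?k - 2) \<le> signed_flow (delete_edge G e) t"
        by (rule order_trans[OF mono[OF drop[OF finite_multigraph_delete[OF fin]]] IH_delete[OF e del]])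
      moreover have drop_contract: "degree_three_verts G - {u, v} \<subseteq> degree_three_verts (contract_edge G e u v)"
        using degree_at_contract(2)[OF fin e uv \<open>u \<noteq> v\<close>] by (auto simp: degree_three_verts_def)
      moreover have "finite_multigraph (contract_edge G e u v)"
        using two_edge_connected_contract[OF less.prems e uv \<open>u \<noteq> v\<close>]
        by (simp add: two_edge_connected_def)
      then have "sqrt 2 ^ (?k - 2) \<le> signed_flow (contract_edge G e u v) t"
        using order_trans[OF mono[OF drop] IH_contract[OF e uv \<open>u \<noteq> v\<close>]] drop_contract by blast
      ultimately have "sqrt 2 ^ (?k - 2) + sqrt 2 ^ (?k - 2) \<le> signed_flow G t"
        using signed_flow_deletion_contraction[OF fin e uv \<open>u \<noteq> v\<close>, of t] by simp
      \<comment> \<open>For \<open>?k < 2\<close> the subtraction truncates, which only improves the bound.\<close>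
      moreover have "sqrt 2 ^ ?k \<le> sqrt 2 ^ (2 + (?k - 2))" by (intro mono) simp
      then have "sqrt 2 ^ ?k \<le> 2 * sqrt 2 ^ (?k - 2)" unfolding power_add by simp
      ultimately show ?thesis by simp
    next
      case False
      then obtain v where v: "v \<in> verts G" "degree_at G v = 2"
        using removable_edge_or_degree_two[OF less.prems loopless] by blast
      then have "(\<Sum>e\<in>edges G. count (ends G e) v) \<noteq> 0" by (simp add: degree_at_def)
      then obtain e where "e \<in> edges G" "count (ends G e) v \<noteq> 0" by (rule sum.not_neutral_contains_not_neutral)
      then have e: "e \<in> edges G" "v \<in># ends G e" by auto
      obtain a b where "ends G e = {#a, b#}" using ends_cases[OF fin e(1)] .
      then obtain u where uv: "ends G e = {#u, v#}" using e(2) by (auto simp: add_mset_commute)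
      with loopless(2)[OF e(1)] have "u \<noteq> v" by blast
      note contr = e(1) uv \<open>u \<noteq> v\<close>
      have "degree_three_verts G \<subseteq> degree_three_verts (contract_edge G e u v)"
      proof
        fix w assume w: "w \<in> degree_three_verts G"
        then have "w \<noteq> v" using v(2) by (auto simp: degree_three_verts_def)
        with w show "w \<in> degree_three_verts (contract_edge G e u v)"
          using degree_at_contract[OF fin contr] v(2)
          by (cases "w = u") (auto simp: degree_three_verts_def)
      qed
      moreover have "finite_multigraph (contract_edge G e u v)"
        using two_edge_connected_contract[OF less.prems contr] by (simp add: two_edge_connected_def)
      ultimately have "?k \<le> card (degree_three_verts (contract_edge G e u v))"
        by (intro card_mono finite_degree_three_verts)
      then have "sqrt 2 ^ ?k \<le> signed_flow (contract_edge G e u v) t"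
        by (rule order_trans[OF mono IH_contract[OF contr]])
      moreover have "0 \<le> signed_flow (delete_edge G e) t"
      proof (rule signed_flow_delete_nonneg[OF less.prems e(1)])
        assume "two_edge_connected (delete_edge G e)"
        then show "0 \<le> signed_flow (delete_edge G e) t" using False e(1) by blast
      qed
      ultimately show ?thesis using signed_flow_deletion_contraction[OF fin contr, of t] by simp
    qed
  qed
qed

section \<open>Bridgeless connected graphs\<close>

lemma nullity_mono:
  assumes fin: "finite_multigraph G" and "finite D" "D \<inter> Z = {}" "Z \<union> D \<subseteq> edges G"
  shows "card Z + num_components G Z \<le> card (Z \<union> D) + num_components G (Z \<union> D)"
  using assms(2-)
proof (induction D rule: finite_induct)
  case (insert e D)
  let ?Y = "Z \<union> D"
  have sub: "insert e ?Y \<subseteq> edges G" using insert.prems by auto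
  have "finite ?Y" using sub fin finite_subset by (auto simp: finite_multigraph_def)
  moreover have "e \<notin> ?Y" using insert by auto
  moreover have "num_components G ?Y \<le> Suc (num_components G (insert e ?Y))"
    by (rule num_components_le_Suc_insert[OF fin sub])
  ultimately show ?case using insert by simp
qed simp

text \<open>The nullity of an edge set is monotone, and deleting a single edge of a bridgeless graph lowers it.
So only the full edge set reaches the top exponent.\<close>

lemma flow_poly_monic:
  assumes fin: "finite_multigraph G" and conn: "connected_graph G" and "bridgeless G"
  shows "degree (flow_poly G) = card (edges G) + 1 - card (verts G)" and "lead_coeff (flow_poly G) = 1"
proof -
  let ?E = "edges G" and ?D = "card (edges G) + 1 - card (verts G)"
  have finE: "finite ?E" using fin by (simp add: finite_multigraph_def)
  have less: "card Z + num_components G Z - card (verts G) < ?D" if Z: "Z \<subset> ?E" for Z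
  proof -
    obtain e where e: "e \<in> ?E" "e \<notin> Z" using Z by blast
    have "num_components G (?E - {e}) \<le> 1"
      using \<open>bridgeless G\<close> conn e(1) by (fastforce simp: bridgeless_def bridge_def connected_graph_def)
    moreover have "Z \<union> (?E - {e} - Z) = ?E - {e}" using Z e by blast
    then have "card Z + num_components G Z \<le> card (?E - {e}) + num_components G (?E - {e})"
      using nullity_mono[OF fin, of "?E - {e} - Z" Z] finE by auto
    moreover have "card ?E = Suc (card (?E - {e}))" using finE e(1) by (rule card.remove)
    moreover have "card (verts G) \<le> card Z + num_components G Z"
      using Z by (intro card_verts_le[OF fin]) auto
    ultimately show ?thesis by linarith
  qed
  have "flow_poly G = (\<Sum>Z\<in>insert ?E (Pow ?E - {?E}). flow_term G Z)"
    unfolding flow_poly_def flow_term_def by (intro sum.cong) auto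
  also have "\<dots> = flow_term G ?E + (\<Sum>Z\<in>Pow ?E - {?E}. flow_term G Z)"
    by (rule sum.insert) (use finE in auto)
  also have "flow_term G ?E = monom 1 ?D" using conn by (simp add: flow_term_def connected_graph_def)
  finally have split: "flow_poly G = monom 1 ?D + (\<Sum>Z\<in>Pow ?E - {?E}. flow_term G Z)" .
  have zero: "coeff (flow_term G Z) i = 0" if "Z \<in> Pow ?E - {?E}" "i \<ge> ?D" for Z i
  proof -
    have "Z \<subset> ?E" using that(1) by blast
    from less[OF this] that(2) show ?thesis by (simp add: flow_term_def)
  qed
  have coeff: "coeff (flow_poly G) i = (if i = ?D then 1 else 0)" if "i \<ge> ?D" for i
    unfolding split coeff_add coeff_sum using zero that by (simp add: sum.neutral)
  have "degree (flow_poly G) \<le> ?D" by (rule degree_le) (simp add: coeff)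
  moreover have "?D \<le> degree (flow_poly G)" by (rule le_degree) (simp add: coeff)
  ultimately show deg: "degree (flow_poly G) = ?D" by simp
  show "lead_coeff (flow_poly G) = 1" unfolding deg by (simp add: coeff)
qed

lemma two_edge_connected_if_bridgeless:
  assumes fin: "finite_multigraph G" and conn: "connected_graph G" and "bridgeless G"
  shows "two_edge_connected G"
proof -
  let ?E = "edges G"
  have one: "num_components G ?E = 1" using conn by (simp add: connected_graph_def)
  have V: "verts G \<noteq> {}" using one by (auto simp: num_components_def quotient_def)
  have "2 \<le> card (cut_edges G X)" if X: "X \<subset> verts G" "X \<noteq> {}" for X
  proof -
    have "cut_edges G X \<noteq> {}"
    proof
      assume "cut_edges G X = {}"
      then have "{{}, X, verts G} \<subseteq> unsplit_sets G ?E"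
        using X fin by (auto simp: unsplit_sets_def cut_edges_def splits_def finite_multigraph_def)
      then have "card {{}, X, verts G} \<le> card (unsplit_sets G ?E)"
        by (rule card_mono[OF finite_unsplit_sets[OF fin]])
      moreover have "card {{}, X, verts G} = 3" using X V by auto
      moreover have "card (unsplit_sets G ?E) = 2"
        using two_power_num_components[OF fin order_refl] one by simp
      ultimately show False by simp
    qed
    moreover have "cut_edges G X \<noteq> {e}" for e
    proof
      assume cut: "cut_edges G X = {e}"
      then have e: "e \<in> ?E" and split: "splits (set_mset (ends G e)) X" by (auto simp: cut_edges_def)
      have "X \<in> unsplit_sets G (?E - {e})" using cut X by (auto simp: unsplit_sets_def cut_edges_def)
      then have "num_components G (?E - {e}) = Suc (num_components G (insert e (?E - {e})))"
        using e split by (intro num_components_insert_less[OF fin]) auto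
      then have "bridge G e" using e by (simp add: bridge_def insert_absorb)
      then show False using \<open>bridgeless G\<close> e by (simp add: bridgeless_def)
    qed
    ultimately have "card (cut_edges G X) \<noteq> 0" "card (cut_edges G X) \<noteq> 1"
      using finite_cut_edges[OF fin, of X] by (auto simp: card_1_singleton_iff)
    then show ?thesis by linarith
  qed
  then show ?thesis using fin V by (simp add: two_edge_connected_def)
qed

lemma sum_degrees:
  assumes fin: "finite_multigraph G"
  shows "(\<Sum>v\<in>verts G. degree_at G v) = 2 * card (edges G)"
proof -
  have finV: "finite (verts G)" using fin by (simp add: finite_multigraph_def)
  have "(\<Sum>v\<in>verts G. degree_at G v) = (\<Sum>e\<in>edges G. \<Sum>v\<in>verts G. count (ends G e) v)"
    unfolding degree_at_def by (rule sum.swap)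
  also have "\<dots> = (\<Sum>e\<in>edges G. 2)"
  proof (rule sum.cong[OF refl])
    fix e assume "e \<in> edges G"
    then obtain u v where "ends G e = {#u, v#}" "u \<in> verts G" "v \<in> verts G" using ends_cases[OF fin] by blast
    moreover from this have count_eq: "count (ends G e) w = (if w = u then 1 else 0) + (if w = v then 1 else 0)" for w
      by simp
    ultimately show "(\<Sum>v\<in>verts G. count (ends G e) v) = 2"
      using sum.distrib[of "\<lambda>w. if w = u then 1 else 0" "\<lambda>w. if w = v then 1 else (0::nat)" "verts G"] finV
      by (simp add: count_eq)
  qed
  finally show ?thesis by simp
qed

section \<open>Coefficients for cubic graphs\<close>

theorem theorem1p4:
  fixes G :: "('v, 'e) multigraph" and n m i :: nat
  assumes "finite_multigraph G"
    and "card (verts G) = n" and "card (edges G) = m"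
    and "connected_graph G" and "bridgeless G" and "cubic G"
    and "\<forall>z. flow_root G z \<longrightarrow> z \<in> \<real>"
    and "i \<le> m - n + 1"
  shows "coeff ([:1, 1:] * [:2, 1:] ^ (n div 2)) i \<le> \<bar>coeff (flow_poly G) i\<bar>"
proof -
  define d where "d = n div 2"
  define p where "p = map_poly real_of_int (flow_poly G)"
  note fin = assms(1)
  have two: "two_edge_connected G"
    by (rule two_edge_connected_if_bridgeless) (use assms in auto)
  then have V: "verts G \<noteq> {}" by (simp add: two_edge_connected_def)
  then have "n > 0" using fin assms(2) by (auto simp: finite_multigraph_def)
  have "degree_three_verts G = verts G" using assms(6) by (auto simp: degree_three_verts_def cubic_def)
  have "3 * n = 2 * m"
    using sum_degrees[OF fin] assms(2,3,6) by (simp add: cubic_def)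
  then have n_eq: "n = 2 * (m - n)" by arith
  then have d: "d = m - n" unfolding d_def by (subst n_eq) simp
  have n: "n = 2 * d" and m: "m + 1 - n = Suc d"
    using n_eq \<open>3 * n = 2 * m\<close> \<open>n > 0\<close> unfolding d by arith+
  have deg_p: "degree p = Suc d" and lead_p: "lead_coeff p = 1"
    using flow_poly_monic[OF fin assms(4,5)] assms(2,3) m
    by (simp_all add: p_def degree_map_poly coeff_map_poly)
  obtain e where e: "e \<in> edges G" using \<open>3 * n = 2 * m\<close> \<open>n > 0\<close> assms(3) by fastforce
  have bound: "sqrt 2 ^ n \<le> \<bar>poly p t\<bar>" if "t \<le> 0" for t
  proof -
    have "sqrt 2 ^ n \<le> signed_flow G t"
      using signed_flow_ge[OF two that] \<open>degree_three_verts G = verts G\<close> assms(2) by simp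
    also have "\<dots> \<le> \<bar>signed_flow G t\<bar>" by simp
    also have "\<dots> = \<bar>poly p t\<bar>" by (simp add: signed_flow_def p_def abs_mult power_abs)
    finally show ?thesis .
  qed
  have "poly p 1 = 0"
    using poly_flow_poly_1[OF fin e] poly_map_poly_of_int[of "flow_poly G" 1, where 'a = real]
    by (simp add: p_def)
  then obtain q where q: "p = [:- 1, 1:] * q" by (auto simp: poly_eq_0_iff_dvd)
  have "q \<noteq> 0" using lead_p q by auto
  then have deg_q: "degree q = d" using deg_p unfolding q by (subst (asm) degree_mult_eq) auto
  have lead_q: "lead_coeff q = 1" using lead_p unfolding q lead_coeff_mult by simp
  have "z \<in> \<real>" if z: "poly (map_poly complex_of_real q) z = 0" for z
  proof -
    have "map_poly of_int (flow_poly G) = map_poly complex_of_real p"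
      by (simp add: p_def map_poly_map_poly o_def)
    also have "\<dots> = map_poly of_real [:- 1, 1:] * map_poly of_real q"
      by (simp only: q map_poly_of_real_mult)
    finally have "flow_root G z" using z by (simp add: flow_root_def)
    then show ?thesis using assms(7) by blast
  qed
  from monic_real_rooted_factorization[OF lead_q this]
  obtain r where r: "q = (\<Prod>j<d. [:- r j, 1:])" unfolding deg_q by blast
  have r_pos: "r j > 0" if "j < d" for j
  proof (rule ccontr)
    assume "\<not> r j > 0"
    then have "sqrt 2 ^ n \<le> \<bar>poly p (r j)\<bar>" by (intro bound) simp
    moreover have "poly p (r j) = 0" using that by (auto simp: q r poly_prod)
    moreover have "sqrt 2 ^ n > 0" by simp
    ultimately show False by simp
  qed
  have "sqrt 2 ^ n \<le> \<bar>poly p 0\<bar>" by (rule bound) simp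
  also have "\<dots> = (\<Prod>j<d. \<bar>r j\<bar>)" by (simp add: q r poly_prod abs_prod)
  also have "\<dots> = (\<Prod>j<d. r j)" using r_pos by (intro prod.cong) (auto intro: abs_of_pos)
  also have "sqrt 2 ^ n = 2 ^ d" by (simp add: n power_mult)
  finally have prod_r: "2 ^ d \<le> (\<Prod>j<d. r j)" .
  have ge: "coeff ([:2, 1:] ^ d) k \<le> coeff (\<Prod>j<d. [:r j, 1:]) k" for k
    using coeff_prod_linear_ge[of "{..<d}" r 2 k] r_pos prod_r by simp
  \<comment> \<open>The roots of \<open>q\<close> together with the root \<open>1\<close> of the cofactor, so that the sign lemma covers \<open>p\<close>.\<close>
  define s where "s = r(d := 1)"
  have "p = (\<Prod>j<Suc d. [:- s j, 1:])" by (simp add: q r s_def mult.commute)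
  then have "\<bar>coeff p i\<bar> = coeff (\<Prod>j<Suc d. [:s j, 1:]) i"
    using r_pos by (simp only:) (rule coeff_prod_linear_abs, auto simp: s_def less_Suc_eq)
  also have "(\<Prod>j<Suc d. [:s j, 1:]) = [:1, 1:] * (\<Prod>j<d. [:r j, 1:])" by (simp add: s_def mult.commute)
  finally have abs_p: "\<bar>coeff p i\<bar> = coeff ([:1, 1:] * (\<Prod>j<d. [:r j, 1:])) i" .
  have pow: "map_poly real_of_int ([:2, 1:] ^ k) = [:2, 1:] ^ k" for k
    by (induction k) (simp_all only: power_0 power_Suc map_poly_of_int_mult, simp_all add: map_poly_pCons)
  have "real_of_int (coeff ([:1, 1:] * [:2, 1:] ^ d) i)
      = coeff (map_poly real_of_int ([:1, 1:] * [:2, 1:] ^ d)) i" by (simp add: coeff_map_poly)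
  also have "\<dots> = coeff ([:1, 1:] * [:2, 1:] ^ d) i"
    by (simp only: map_poly_of_int_mult pow) (simp add: map_poly_pCons)
  also have "\<dots> \<le> coeff ([:1, 1:] * (\<Prod>j<d. [:r j, 1:])) i"
    using ge by (cases i) (simp_all add: add_mono)
  also have "\<dots> = real_of_int \<bar>coeff (flow_poly G) i\<bar>"
    unfolding abs_p[symmetric] by (simp add: p_def coeff_map_poly)
  finally show ?thesis unfolding d_def by (simp only: of_int_le_iff)
qed

end
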